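(* Let $\mathcal{J}$ be a Borel ideal on $\omega$, let $\mathcal{D}$ be one of $[\omega]^\omega$, $\mathcal{J}^+$, or $\mathcal{J}^*$, and let $I$ be a $\sigma$-ideal on an uncountable Polish space $X$ such that the forcing $\mathbb{P}_I$ is proper. Then $\mathbb{P}_I$ cannot $\mathcal{D}$-destroy $\mathcal{J}$ if and only if for every sequence $(B_n)_{n\in\omega}$ of Borel subsets of $X$ the following holds: if $\{x\in X:\{n\in\omega:x\in B_n\}\in\mathcal{D}\}\in I^+$, then there is $S\in\mathcal{J}$ such that $\{x\in X:|\{n\in S:x\in B_n\}|=\omega\}\in I^+$.
   Context: Ideals on $\omega$ contain all finite sets and are proper; $\mathcal{J}^+=\mathcal{P}(\omega)\setminus\mathcal{J}$, $\mathcal{J}^*=\{\omega\setminus A:A\in\mathcal{J}\}$, and Borel refers to $\mathcal{P}(\omega)\cong 2^\omega$. For a $\sigma$-ideal $I$ on $X$, $I^+$ is the family of subsets of $X$ not in $I$, and $\mathbb{P}_I$ is the poset of Borel subsets of $X$ not in $I$, ordered by inclusion. For $\mathcal{D}\in\{[\omega]^\omega,\mathcal{J}^+,\mathcal{J}^*\}$ (with $\mathcal{J}^+,\mathcal{J}^*$ interpreted in the extension), a forcing $\mathbb{P}$ can $\mathcal{D}$-destroy $\mathcal{J}$ if there is $p\in\mathbb{P}$ forcing that there exists $Y\in\mathcal{D}$ with $|Y\cap A|<\omega$ for every $A\in\mathcal{J}\cap V$ (ground model elements of $\mathcal{J}$). *)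

theory Defs
  imports "HOL-Analysis.Analysis"
begin

section \<open>Ideals\<close>

definition ideal_on_omega :: "nat set set \<Rightarrow> bool" where
  "ideal_on_omega J \<longleftrightarrow>
     (\<forall>A. finite A \<longrightarrow> A \<in> J) \<and>
     (\<forall>A B. A \<in> J \<and> B \<subseteq> A \<longrightarrow> B \<in> J) \<and>
     (\<forall>A B. A \<in> J \<and> B \<in> J \<longrightarrow> A \<union> B \<in> J) \<and>
     UNIV \<notin> J"

text \<open>\<^term>\<open>Collect\<close> is the identification of \<open>2\<^sup>\<omega>\<close> with \<open>P(\<omega>)\<close>; \<^typ>\<open>nat \<Rightarrow> bool\<close>
  carries the product topology.\<close>

definition borel_family :: "nat set set \<Rightarrow> bool" where
  "borel_family J \<longleftrightarrow> (Collect :: (nat \<Rightarrow> bool) \<Rightarrow> nat set) -` J \<in> sets borel"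

definition positive_sets :: "nat set set \<Rightarrow> nat set set" where
  "positive_sets J = UNIV - J"

definition dual_filter :: "nat set set \<Rightarrow> nat set set" where
  "dual_filter J = {UNIV - A |A. A \<in> J}"

definition sigma_ideal :: "'a set set \<Rightarrow> bool" where
  "sigma_ideal I \<longleftrightarrow>
     {} \<in> I \<and>
     (\<forall>A B. A \<in> I \<and> B \<subseteq> A \<longrightarrow> B \<in> I) \<and>
     (\<forall>F :: nat \<Rightarrow> 'a set. range F \<subseteq> I \<longrightarrow> (\<Union>n. F n) \<in> I)"

section \<open>Forcing notions\<close>

text \<open>A forcing notion is a carrier \<open>P\<close> with an order \<open>le\<close>; \<open>le q p\<close> means that \<open>q\<close> is stronger
  than \<open>p\<close>.\<close>

definition P_ideal :: "'a::topological_space set set \<Rightarrow> 'a set set" where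
  "P_ideal I = {B \<in> sets borel. B \<notin> I}"

definition compatible :: "'p set \<Rightarrow> ('p \<Rightarrow> 'p \<Rightarrow> bool) \<Rightarrow> 'p \<Rightarrow> 'p \<Rightarrow> bool" where
  "compatible P le p q \<longleftrightarrow> (\<exists>r\<in>P. le r p \<and> le r q)"

definition dense_in :: "'p set \<Rightarrow> ('p \<Rightarrow> 'p \<Rightarrow> bool) \<Rightarrow> 'p set \<Rightarrow> bool" where
  "dense_in P le D \<longleftrightarrow> D \<subseteq> P \<and> (\<forall>p\<in>P. \<exists>d\<in>D. le d p)"

definition dense_below :: "'p set \<Rightarrow> ('p \<Rightarrow> 'p \<Rightarrow> bool) \<Rightarrow> 'p \<Rightarrow> ('p \<Rightarrow> bool) \<Rightarrow> bool" where
  "dense_below P le p Q \<longleftrightarrow> (\<forall>q\<in>P. le q p \<longrightarrow> (\<exists>r\<in>P. le r q \<and> Q r))"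

definition predense_below :: "'p set \<Rightarrow> ('p \<Rightarrow> 'p \<Rightarrow> bool) \<Rightarrow> 'p \<Rightarrow> 'p set \<Rightarrow> bool" where
  "predense_below P le q D \<longleftrightarrow> (\<forall>r\<in>P. le r q \<longrightarrow> (\<exists>d\<in>D. compatible P le r d))"

section \<open>Properness\<close>

text \<open>
  Properness is defined through countable elementary submodels of \<open>H(\<theta>)\<close>. A well-founded tree with
  branches indexed by (part of) the type \<open>'k\<close> and with urelements as leaves stands for a set; two
  trees are identified if they stand for the same set. The quotient \<open>('u, 'k) hereditary\<close> is
  \<open>H(\<kappa>\<^sup>+)\<close> over the urelements \<open>'u\<close>, with \<open>\<kappa>\<close> the (infinite) cardinality of \<open>'k\<close>: the urelements
  together with all sets hereditarily of cardinality at most \<open>\<kappa>\<close>.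
\<close>

datatype ('u, 'k) set_tree = Ur 'u | Coll "'k \<Rightarrow> ('u, 'k) set_tree option"

inductive set_tree_eq :: "('u, 'k) set_tree \<Rightarrow> ('u, 'k) set_tree \<Rightarrow> bool" where
  "set_tree_eq (Ur u) (Ur u)"
| "(\<forall>s\<in>ran f. \<exists>t\<in>ran g. set_tree_eq s t) \<Longrightarrow> (\<forall>t\<in>ran g. \<exists>s\<in>ran f. set_tree_eq s t) \<Longrightarrow>
     set_tree_eq (Coll f) (Coll g)"

lemma set_tree_eq_refl: "set_tree_eq t t"
proof (induction t)
  case (Coll f)
  have "set_tree_eq s s" if "s \<in> ran f" for s
    using that Coll by (fastforce simp: ran_def)
  then show ?case by (blast intro: set_tree_eq.intros)
qed (rule set_tree_eq.intros)

lemma set_tree_eq_sym: "set_tree_eq s t \<Longrightarrow> set_tree_eq t s"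
  by (induction rule: set_tree_eq.induct) (blast intro: set_tree_eq.intros)+

lemma set_tree_eq_trans: "set_tree_eq s t \<Longrightarrow> set_tree_eq t u \<Longrightarrow> set_tree_eq s u"
proof (induction arbitrary: u rule: set_tree_eq.induct)
  case (2 f g)
  from "2.prems" obtain h where u: "u = Coll h"
    and gh: "\<forall>s\<in>ran g. \<exists>t\<in>ran h. set_tree_eq s t" "\<forall>t\<in>ran h. \<exists>s\<in>ran g. set_tree_eq s t"
    by (cases rule: set_tree_eq.cases) auto
  show ?case
    unfolding u using "2.IH" gh by (intro set_tree_eq.intros) meson+
qed

quotient_type ('u, 'k) hereditary = "('u, 'k) set_tree" / set_tree_eq
  by (intro equivpI reflpI sympI transpI)
    (blast intro: set_tree_eq_refl set_tree_eq_sym set_tree_eq_trans)+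

lift_definition urelement :: "'u \<Rightarrow> ('u, 'k) hereditary" is Ur .

lift_definition mem :: "('u, 'k) hereditary \<Rightarrow> ('u, 'k) hereditary \<Rightarrow> bool"
  is "\<lambda>s t. \<exists>f. t = Coll f \<and> (\<exists>s'\<in>ran f. set_tree_eq s s')"
proof -
  have imp: "\<exists>f. t' = Coll f \<and> (\<exists>r\<in>ran f. set_tree_eq s' r)"
    if st: "set_tree_eq s s'" "set_tree_eq t t'" and ex: "\<exists>f. t = Coll f \<and> (\<exists>r\<in>ran f. set_tree_eq s r)"
    for s s' t t' :: "('u, 'k) set_tree"
  proof -
    obtain f r where f: "t = Coll f" "r \<in> ran f" "set_tree_eq s r" using ex by blast
    obtain g where g: "t' = Coll g" "\<forall>s\<in>ran f. \<exists>t\<in>ran g. set_tree_eq s t"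
      using st(2) unfolding f(1) by (cases rule: set_tree_eq.cases) auto
    then obtain r' where "r' \<in> ran g" "set_tree_eq r r'" using f(2) by blast
    then show ?thesis
      using g(1) f(3) st(1) by (blast intro: set_tree_eq_sym set_tree_eq_trans)
  qed
  show "(\<exists>f. t = Coll f \<and> (\<exists>r\<in>ran f. set_tree_eq s r)) \<longleftrightarrow>
        (\<exists>f. t' = Coll f \<and> (\<exists>r\<in>ran f. set_tree_eq s' r))"
    if "set_tree_eq s s'" "set_tree_eq t t'" for s s' t t' :: "('u, 'k) set_tree"
    using imp[of s s' t t'] imp[of s' s t' t] that set_tree_eq_sym by blast
qed

text \<open>\<open>is_set a S\<close>: the object \<open>a\<close> of \<open>H(\<kappa>\<^sup>+)\<close> is the set whose elements are those of \<open>S\<close>.\<close>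

definition is_set :: "('u, 'k) hereditary \<Rightarrow> ('u, 'k) hereditary set \<Rightarrow> bool" where
  "is_set a S \<longleftrightarrow> a \<notin> range urelement \<and> {b. mem b a} = S"

definition is_pair :: "('u, 'k) hereditary \<Rightarrow> ('u, 'k) hereditary \<Rightarrow> ('u, 'k) hereditary \<Rightarrow> bool" where
  "is_pair a x y \<longleftrightarrow> (\<exists>u v. is_set u {x} \<and> is_set v {x, y} \<and> is_set a {u, v})"

datatype fm = FMem nat nat | FEq nat nat | FUr nat | FNeg fm | FAnd fm fm | FEx nat fm

primrec sat :: "('u, 'k) hereditary set \<Rightarrow> fm \<Rightarrow> (nat \<Rightarrow> ('u, 'k) hereditary) \<Rightarrow> bool" where
  "sat M (FMem i j) v \<longleftrightarrow> mem (v i) (v j)"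
| "sat M (FEq i j) v \<longleftrightarrow> v i = v j"
| "sat M (FUr i) v \<longleftrightarrow> v i \<in> range urelement"
| "sat M (FNeg \<phi>) v \<longleftrightarrow> \<not> sat M \<phi> v"
| "sat M (FAnd \<phi> \<psi>) v \<longleftrightarrow> sat M \<phi> v \<and> sat M \<psi> v"
| "sat M (FEx i \<phi>) v \<longleftrightarrow> (\<exists>a\<in>M. sat M \<phi> (v(i := a)))"

definition elementary_submodel :: "('u, 'k) hereditary set \<Rightarrow> bool" where
  "elementary_submodel M \<longleftrightarrow>
     M \<noteq> {} \<and> (\<forall>\<phi> v. range v \<subseteq> M \<longrightarrow> (sat M \<phi> v \<longleftrightarrow> sat UNIV \<phi> v))"

definition generic_condition ::
    "('p, 'k) hereditary set \<Rightarrow> 'p set \<Rightarrow> ('p \<Rightarrow> 'p \<Rightarrow> bool) \<Rightarrow> 'p \<Rightarrow> bool" where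
  "generic_condition M P le q \<longleftrightarrow>
     (\<forall>D. dense_in P le D \<and> (\<exists>a\<in>M. is_set a (urelement ` D)) \<longrightarrow>
        predense_below P le q {d \<in> D. urelement d \<in> M})"

text \<open>
  Here \<open>\<theta> = \<kappa>\<^sup>+\<close> with \<open>\<kappa>\<close> the cardinality of \<open>('p \<times> nat) set\<close>, so \<open>\<theta>\<close> is regular, uncountable and
  larger than \<open>2 ^ |P|\<close>; any other such \<open>\<theta>\<close> gives an equivalent notion. The conditions are the
  urelements; being proper is invariant under isomorphism of forcing notions.
\<close>

definition proper_forcing :: "'p set \<Rightarrow> ('p \<Rightarrow> 'p \<Rightarrow> bool) \<Rightarrow> bool" where
  "proper_forcing P le \<longleftrightarrow>
     (\<forall>M :: ('p, ('p \<times> nat) set) hereditary set.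
        countable M \<and> elementary_submodel M \<and>
        (\<exists>a\<in>M. is_set a (urelement ` P)) \<and>
        (\<exists>a\<in>M. is_set a {z. \<exists>p\<in>P. \<exists>q\<in>P. le p q \<and> is_pair z (urelement p) (urelement q)}) \<longrightarrow>
        (\<forall>p\<in>P. urelement p \<in> M \<longrightarrow> (\<exists>q\<in>P. le q p \<and> generic_condition M P le q)))"

section \<open>Forcing statements about a name for a subset of \<open>\<omega>\<close>\<close>

text \<open>Borel codes for subsets of \<open>P(\<omega>)\<close>, with their evaluation in the ground model.\<close>

datatype bcode = BEmpty | BMem nat | BCompl bcode | BUnion "nat \<Rightarrow> bcode"

primrec decode :: "bcode \<Rightarrow> nat set set" where
  "decode BEmpty = {}"
| "decode (BMem n) = {Y. n \<in> Y}"
| "decode (BCompl c) = UNIV - decode c"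
| "decode (BUnion f) = (\<Union>n. decode (f n))"

instance bool :: second_countable_topology
proof
  have "open = generate_topology (UNIV :: bool set set)"
    by (auto simp: fun_eq_iff open_discrete intro: generate_topology.Basis)
  then show "\<exists>B :: bool set set. countable B \<and> open = generate_topology B"
    by (intro exI[of _ UNIV]) (simp add: countable_finite)
qed

lemma borel_family_iff_decode: "borel_family J \<longleftrightarrow> (\<exists>c. decode c = J)"
proof
  let ?C = "Collect :: (nat \<Rightarrow> bool) \<Rightarrow> nat set"
  assume "\<exists>c. decode c = J"
  then obtain c where c: "decode c = J" by blast
  have "?C -` decode c \<in> sets borel"
  proof (induction c)
    case (BMem n)
    have "(\<lambda>f :: nat \<Rightarrow> bool. f n) \<in> borel_measurable borel"
      by (intro borel_measurable_continuous_onI continuous_on_product_coordinates)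
    from measurable_sets[OF this, of "{True}"] show ?case
      by (simp add: vimage_def)
  next
    case (BCompl c)
    then show ?case using sets.compl_sets[OF BCompl] by (simp add: vimage_Diff)
  next
    case (BUnion f)
    then show ?case by (simp add: vimage_UN)
  qed simp
  then show "borel_family J" by (simp add: borel_family_def c)
next
  let ?C = "Collect :: (nat \<Rightarrow> bool) \<Rightarrow> nat set"
  assume "borel_family J"
  then have "?C -` J \<in> sets (PiM UNIV (\<lambda>i::nat. borel :: bool measure))"
    by (simp add: borel_family_def sets_PiM_equal_borel)
  then have "?C -` J \<in> sigma_sets UNIV {{f. f i \<in> A} |i A. A \<in> sets (borel :: bool measure)}"
    by (simp add: sets_PiM_single space_borel)
  then have "\<exists>c. ?C -` decode c = ?C -` J"
  proof (induction rule: sigma_sets.induct)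
    case (Basic a)
    then obtain i and A :: "bool set" where a: "a = {f. f i \<in> A}" by blast
    have "A \<in> Pow {True, False}" by auto
    then consider "A = {}" | "A = {True}" | "A = {False}" | "A = UNIV"
      by (auto simp: Pow_insert UNIV_bool)
    then show ?case
    proof cases
      case 1 then show ?thesis by (intro exI[of _ BEmpty]) (simp add: a)
    next
      case 2 then show ?thesis by (intro exI[of _ "BMem i"]) (auto simp: a)
    next
      case 3 then show ?thesis by (intro exI[of _ "BCompl (BMem i)"]) (auto simp: a)
    next
      case 4 then show ?thesis by (intro exI[of _ "BCompl BEmpty"]) (auto simp: a)
    qed
  next
    case Empty
    show ?case by (intro exI[of _ BEmpty]) simp
  next
    case (Compl a)
    then obtain c where "?C -` decode c = a" by blast
    then show ?case by (intro exI[of _ "BCompl c"]) auto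
  next
    case (Union a)
    then have "\<exists>F. \<forall>i. ?C -` decode (F i) = a i" by (intro choice) blast
    then obtain F where "\<forall>i. ?C -` decode (F i) = a i" by blast
    then show ?case by (intro exI[of _ "BUnion F"]) auto
  qed
  then obtain c where c: "?C -` decode c = ?C -` J" by blast
  have "surj ?C" by (metis Collect_mem_eq surjI)
  then show "\<exists>c. decode c = J" using c by (metis surj_image_vimage_eq)
qed

text \<open>
  A name for a subset of \<open>\<omega>\<close> is a set of pairs of a (check name of a) natural number and a condition;
  \<open>Y n\<close> collects the conditions paired with \<open>n\<close>. Every subset of \<open>\<omega>\<close> in the extension has such a
  name.
\<close>

type_synonym 'p real_name = "nat \<Rightarrow> 'p set"

definition is_name :: "'p set \<Rightarrow> 'p real_name \<Rightarrow> bool" where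
  "is_name P Y \<longleftrightarrow> (\<forall>n. Y n \<subseteq> P)"

text \<open>\<open>forces P le Y c p\<close>: the condition \<open>p\<close> forces that (the value of) \<open>Y\<close> belongs to the Borel set
  that the ground model code \<open>c\<close> describes in the extension.\<close>

primrec forces :: "'p set \<Rightarrow> ('p \<Rightarrow> 'p \<Rightarrow> bool) \<Rightarrow> 'p real_name \<Rightarrow> bcode \<Rightarrow> 'p \<Rightarrow> bool" where
  "forces P le Y BEmpty = (\<lambda>p. False)"
| "forces P le Y (BMem n) = (\<lambda>p. dense_below P le p (\<lambda>r. \<exists>s\<in>Y n. le r s))"
| "forces P le Y (BCompl c) = (\<lambda>p. \<forall>q\<in>P. le q p \<longrightarrow> \<not> forces P le Y c q)"
| "forces P le Y (BUnion f) = (\<lambda>p. dense_below P le p (\<lambda>r. \<exists>n. forces P le Y (f n) r))"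

text \<open>The Borel set with ground model version \<open>D\<close>, interpreted in the extension. By absoluteness the
  choice of the code does not matter.\<close>

definition forces_in :: "'p set \<Rightarrow> ('p \<Rightarrow> 'p \<Rightarrow> bool) \<Rightarrow> 'p real_name \<Rightarrow> nat set set \<Rightarrow> 'p \<Rightarrow> bool" where
  "forces_in P le Y D p \<longleftrightarrow> (\<exists>c. decode c = D \<and> forces P le Y c p)"

text \<open>The code of \<open>{Y. |Y \<inter> A| < \<omega>}\<close>: for some \<open>m\<close>, no \<open>n \<ge> m\<close> in \<open>A\<close> belongs to \<open>Y\<close>.\<close>

definition fin_inter_code :: "nat set \<Rightarrow> bcode" where
  "fin_inter_code A =
     BUnion (\<lambda>m. BCompl (BUnion (\<lambda>n. if m \<le> n \<and> n \<in> A then BMem n else BEmpty)))"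

lemma decode_fin_inter_code: "decode (fin_inter_code A) = {Y. finite (Y \<inter> A)}"
proof -
  have "Y \<in> decode (fin_inter_code A) \<longleftrightarrow> (\<exists>m. \<forall>n. m \<le> n \<and> n \<in> A \<longrightarrow> n \<notin> Y)" for Y
    by (auto simp: fin_inter_code_def split: if_splits)
  moreover have "(\<exists>m. \<forall>n. m \<le> n \<and> n \<in> A \<longrightarrow> n \<notin> Y) \<longleftrightarrow> (\<exists>m. \<forall>n\<in>Y \<inter> A. n < m)" for Y
    by (metis Int_iff not_le)
  ultimately show ?thesis
    by (auto simp: finite_nat_set_iff_bounded)
qed

text \<open>\<open>p\<close> forces: there is \<open>Y\<close> in \<open>D\<close> (interpreted in the extension) such that \<open>|Y \<inter> A| < \<omega>\<close> for every
  \<open>A \<in> J \<inter> V\<close>. An existential statement is forced by \<open>p\<close> iff densely below \<open>p\<close> it has a witnessing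
  name; a universal statement over ground model objects is forced iff all its instances are.\<close>

definition forces_destroyed ::
    "'p set \<Rightarrow> ('p \<Rightarrow> 'p \<Rightarrow> bool) \<Rightarrow> nat set set \<Rightarrow> nat set set \<Rightarrow> 'p \<Rightarrow> bool" where
  "forces_destroyed P le D J p \<longleftrightarrow>
     dense_below P le p (\<lambda>q. \<exists>Y. is_name P Y \<and> forces_in P le Y D q \<and>
        (\<forall>A\<in>J. forces P le Y (fin_inter_code A) q))"

definition can_destroy ::
    "'p set \<Rightarrow> ('p \<Rightarrow> 'p \<Rightarrow> bool) \<Rightarrow> nat set set \<Rightarrow> nat set set \<Rightarrow> bool" where
  "can_destroy P le D J \<longleftrightarrow> (\<exists>p\<in>P. forces_destroyed P le D J p)"

end

theory Submission
  imports Defs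
begin

text \<open>
  A sequence \<open>B\<close> of Borel sets induces the name \<open>n \<mapsto> {p. p \<subseteq> B n}\<close>, and \<open>p\<close> forces its value into a
  Borel set exactly if \<open>I\<close>-almost every \<open>x \<in> p\<close> has \<open>{n. x \<in> B n}\<close> in that set. Hence a sequence
  that violates the combinatorial condition gives a destroying name. Conversely, every name is of
  this form below some stronger condition: if \<open>q\<close> is generic over a countable elementary submodel
  \<open>M\<close> that contains the dense sets deciding \<open>n \<in> Y\<close>, then below \<open>q\<close> the name \<open>Y\<close> is read off from
  the countable unions \<open>B n\<close> of those conditions in \<open>M\<close> that force \<open>n \<in> Y\<close>.
\<close>

section \<open>Countable elementary submodels\<close>

instance fm :: countable
  by countable_datatype

text \<open>A formula mentions only finitely many variables. This lets finite parameter lists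
  replace full valuations when a countable hull is built.\<close>

lemma sat_cong_bounded:
  "\<exists>N. \<forall>v w. (\<forall>n<N. v n = w n) \<longrightarrow> sat M \<phi> v = sat M \<phi> w"
proof (induction \<phi>)
  case (FMem i j)
  show ?case by (rule exI[of _ "Suc (max i j)"]) simp
next
  case (FEq i j)
  show ?case by (rule exI[of _ "Suc (max i j)"]) simp
next
  case (FUr i)
  show ?case by (rule exI[of _ "Suc i"]) simp
next
  case (FNeg \<phi>)
  then show ?case by simp
next
  case (FAnd \<phi> \<psi>)
  then obtain N1 N2 where
    N: "\<And>v w. (\<forall>n<N1. v n = w n) \<Longrightarrow> sat M \<phi> v = sat M \<phi> w"
    "\<And>v w. (\<forall>n<N2. v n = w n) \<Longrightarrow> sat M \<psi> v = sat M \<psi> w" by blast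
  have "sat M \<phi> v = sat M \<phi> w \<and> sat M \<psi> v = sat M \<psi> w" if "\<forall>n<max N1 N2. v n = w n" for v w
    using N[of v w] that by simp
  then show ?case by (intro exI[of _ "max N1 N2"]) auto
next
  case (FEx i \<phi>)
  then obtain N where N: "\<And>v w. (\<forall>n<N. v n = w n) \<Longrightarrow> sat M \<phi> v = sat M \<phi> w" by blast
  have "sat M \<phi> (v(i := a)) = sat M \<phi> (w(i := a))" if "\<forall>n<N. v n = w n" for v w a
    using that by (intro N) simp
  then show ?case by (intro exI[of _ N]) (simp, blast)
qed

text \<open>A countable set has only countably many finite lists, while the valuations over it can
  be uncountably many. The default fills the positions past the end of the list.\<close>

definition list_valuation :: "'b \<Rightarrow> 'b list \<Rightarrow> nat \<Rightarrow> 'b" where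
  "list_valuation d xs n = (if n < length xs then xs ! n else d)"

text \<open>One round of the Skolem hull, with \<open>SOME\<close> in the role of the Skolem
  functions.\<close>

definition skolem_step :: "('u, 'k) hereditary set \<Rightarrow> ('u, 'k) hereditary set" where
  "skolem_step H = H \<union>
     (\<lambda>(i, \<phi>, xs). SOME a. sat UNIV \<phi> ((list_valuation undefined xs)(i := a))) `
       (UNIV \<times> UNIV \<times> lists H)"

text \<open>The hull is the union of countably many rounds. A finite parameter list already lies in
  some finite stage, so its witness enters at the next one. Hence the union passes the Tarski-Vaught
  test, which is the fact \<open>witness\<close>.\<close>

lemma Loewenheim_Skolem:
  fixes C :: "('u, 'k) hereditary set"
  assumes "countable C"
  shows "\<exists>M. countable M \<and> C \<subseteq> M \<and> elementary_submodel M"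
proof -
  define H where "H k = (skolem_step ^^ k) C" for k
  define M where "M = (\<Union>k. H k)"
  have H0: "H 0 = C" and H_Suc: "H (Suc k) = skolem_step (H k)" for k
    by (simp_all add: H_def)
  have "countable (H k)" for k
  proof (induction k)
    case (Suc k)
    then show ?case unfolding H_Suc skolem_step_def by simp
  qed (simp add: H0 assms)
  then have "countable M" by (simp add: M_def)
  have "incseq H" by (rule incseq_SucI) (auto simp: H_Suc skolem_step_def)
  have lists_H: "\<exists>k. set xs \<subseteq> H k" if "set xs \<subseteq> M" for xs
    using that
  proof (induction xs)
    case (Cons x xs)
    then obtain j k where "set xs \<subseteq> H j" "x \<in> H k" by (auto simp: M_def)
    then have "set (x # xs) \<subseteq> H (max j k)"
      using incseqD[OF \<open>incseq H\<close>, of j "max j k"] incseqD[OF \<open>incseq H\<close>, of k "max j k"] by auto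
    then show ?case by blast
  qed simp
  have witness: "\<exists>a\<in>M. sat UNIV \<phi> (v(i := a))"
    if v: "range v \<subseteq> M" and ex: "sat UNIV \<phi> (v(i := b))" for v i \<phi> b
  proof -
    obtain N where N: "\<And>v w :: nat \<Rightarrow> ('u, 'k) hereditary.
        (\<forall>n<N. v n = w n) \<Longrightarrow> sat UNIV \<phi> v = sat UNIV \<phi> w"
      using sat_cong_bounded[of UNIV \<phi>] by blast
    \<comment> \<open>Cutting \<open>v\<close> off at the bound \<open>N\<close> leaves a finite
      list of parameters and keeps the truth value of the formula.\<close>
    define xs where "xs = map v [0..<N]"
    let ?w = "list_valuation undefined xs"
    have eq: "sat UNIV \<phi> (?w(i := a)) = sat UNIV \<phi> (v(i := a))" for a
      by (rule N) (simp add: list_valuation_def xs_def)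
    define a where "a = (SOME a. sat UNIV \<phi> (?w(i := a)))"
    have "sat UNIV \<phi> (?w(i := a))"
      unfolding a_def by (rule someI[of _ b]) (simp only: eq ex)
    moreover obtain k where "set xs \<subseteq> H k"
      using lists_H[of xs] v by (auto simp: xs_def)
    then have "a \<in> H (Suc k)"
      unfolding H_Suc skolem_step_def a_def
      by (intro UnI2 image_eqI[of _ _ "(i, \<phi>, xs)"]) (auto simp: lists_eq_set)
    ultimately show ?thesis by (auto simp: eq M_def)
  qed
  have "sat M \<phi> v \<longleftrightarrow> sat UNIV \<phi> v" if "range v \<subseteq> M" for \<phi> v
    using that
  proof (induction \<phi> arbitrary: v)
    case (FEx i \<phi>)
    have "sat M \<phi> (v(i := a)) = sat UNIV \<phi> (v(i := a))" if "a \<in> M" for a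
      using FEx.prems that by (intro FEx.IH) auto
    then show ?case using witness[OF FEx.prems] by auto
  qed simp_all
  \<comment> \<open>Since \<open>C\<close> may be empty, the witness of a trivial formula shows that
    \<open>M\<close> is nonempty.\<close>
  moreover have "(SOME a. sat UNIV (FEq 0 0) ((list_valuation undefined [])(0 := a))) \<in> H (Suc 0)"
    unfolding H_Suc skolem_step_def by (intro UnI2 image_eqI[of _ _ "(0, FEq 0 0, [])"]) auto
  then have "M \<noteq> {}" by (auto simp: M_def)
  moreover have "C \<subseteq> M" using H0 by (auto simp: M_def)
  ultimately show ?thesis using \<open>countable M\<close> by (auto simp: elementary_submodel_def)
qed

section \<open>Sets of urelements and of pairs of urelements\<close>

lemma mem_abs_Coll_iff: "mem b (abs_hereditary (Coll f)) \<longleftrightarrow> (\<exists>t\<in>ran f. b = abs_hereditary t)"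
  by (induction b rule: hereditary.abs_induct) (simp add: mem.abs_eq hereditary.abs_eq_iff)

lemma urelement_eq_iff: "urelement x = urelement y \<longleftrightarrow> x = y"
  by (auto simp: urelement.abs_eq hereditary.abs_eq_iff set_tree_eq_refl elim: set_tree_eq.cases)

lemma abs_Coll_notin_urelements: "abs_hereditary (Coll f) \<notin> range urelement"
  by (auto simp: urelement.abs_eq hereditary.abs_eq_iff elim: set_tree_eq.cases)

lemma not_urelement_imp_Coll:
  assumes "a \<notin> range urelement"
  obtains f where "a = abs_hereditary (Coll f)"
proof -
  obtain t where t: "a = abs_hereditary t" by (induction a rule: hereditary.abs_induct) blast
  with assms have "t \<noteq> Ur u" for u by (auto simp: urelement.abs_eq)
  with t show ?thesis using that by (cases t) auto
qed

text \<open>Extensionality: the quotient identifies two trees as soon as their members match in both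
  directions.\<close>

lemma is_set_unique:
  assumes "is_set a S" "is_set b S"
  shows "a = b"
proof -
  obtain f g where fg: "a = abs_hereditary (Coll f)" "b = abs_hereditary (Coll g)"
    using assms not_urelement_imp_Coll unfolding is_set_def by metis
  have *: "mem c a \<longleftrightarrow> mem c b" for c
    using assms by (auto simp: is_set_def)
  have "set_tree_eq (Coll f) (Coll g)"
  proof (intro set_tree_eq.intros ballI)
    fix s assume "s \<in> ran f"
    then have "mem (abs_hereditary s) b" using * fg(1) mem_abs_Coll_iff by blast
    then show "\<exists>t\<in>ran g. set_tree_eq s t"
      by (simp add: fg mem_abs_Coll_iff hereditary.abs_eq_iff)
  next
    fix t assume "t \<in> ran g"
    then have "mem (abs_hereditary t) a" using * fg(2) mem_abs_Coll_iff by blast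
    then show "\<exists>s\<in>ran f. set_tree_eq s t"
      by (auto simp: fg mem_abs_Coll_iff hereditary.abs_eq_iff intro: set_tree_eq_sym)
  qed
  then show ?thesis by (simp add: fg hereditary.abs_eq_iff)
qed

text \<open>Branches of a tree are indexed by \<open>'k\<close>, so a family covered by a
  \<open>'k\<close>-indexed enumeration is small enough to be a set. Indices whose value falls
  outside \<open>S\<close> get no branch.\<close>

lemma is_set_exists:
  fixes g :: "'k \<Rightarrow> ('u, 'k) hereditary"
  assumes "S \<subseteq> range g"
  shows "\<exists>a. is_set a S"
proof -
  define f where "f k = (if g k \<in> S then Some (rep_hereditary (g k)) else None)" for k
  have abs_rep: "abs_hereditary (rep_hereditary x) = x" for x :: "('u, 'k) hereditary"
    by (rule Quotient3_abs_rep[OF Quotient3_hereditary])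
  have "mem b (abs_hereditary (Coll f)) \<longleftrightarrow> b \<in> S" for b
  proof
    assume "mem b (abs_hereditary (Coll f))"
    then show "b \<in> S"
      by (auto simp: mem_abs_Coll_iff ran_def f_def abs_rep split: if_splits)
  next
    assume "b \<in> S"
    then obtain k where "b = g k" using assms by blast
    with \<open>b \<in> S\<close> have "rep_hereditary b \<in> ran f" by (auto simp: ran_def f_def)
    then show "mem b (abs_hereditary (Coll f))" by (metis mem_abs_Coll_iff abs_rep)
  qed
  then have "is_set (abs_hereditary (Coll f)) S"
    by (simp add: is_set_def abs_Coll_notin_urelements)
  then show ?thesis by blast
qed

text \<open>A power set as index type always has an index other than \<open>{}\<close>, which is
  available for \<open>y\<close>.\<close>

lemma is_set_doubleton_exists:
  fixes x y :: "('u, 'k set) hereditary"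
  shows "\<exists>a. is_set a {x, y}"
  by (rule is_set_exists[where g = "\<lambda>k. if k = {} then x else y"]) auto

lemma is_pair_exists:
  fixes x y :: "('u, 'k set) hereditary"
  shows "\<exists>a. is_pair a x y"
proof -
  obtain u v where "is_set u {x, x}" "is_set v {x, y}"
    using is_set_doubleton_exists by meson
  moreover obtain a where "is_set a {u, v}"
    using is_set_doubleton_exists by meson
  ultimately show ?thesis by (auto simp: is_pair_def)
qed

lemma is_pair_unique: "is_pair a x y \<Longrightarrow> is_pair b x y \<Longrightarrow> a = b"
  unfolding is_pair_def by (metis is_set_unique)

lemma is_set_urelements_exists:
  fixes D :: "'p set"
  shows "\<exists>a :: ('p, ('p \<times> nat) set) hereditary. is_set a (urelement ` D)"
proof (rule is_set_exists)
  let ?g = "\<lambda>k :: ('p \<times> nat) set. urelement (fst (the_elem k))"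
  have "urelement p = ?g {(p, 0)}" for p by simp
  then show "urelement ` D \<subseteq> range ?g" by blast
qed

lemma is_set_relation_exists:
  fixes P :: "'p set"
  shows "\<exists>a :: ('p, ('p \<times> nat) set) hereditary.
    is_set a {z. \<exists>p\<in>P. \<exists>q\<in>P. le p q \<and> is_pair z (urelement p) (urelement q)}"
proof (rule is_set_exists)
  \<comment> \<open>The index \<open>{(p, 0), (q, 1)}\<close> codes an ordered pair; the tags keep
    the coordinates apart even if \<open>p = q\<close>. As pairs are unique, \<open>SOME\<close>
    returns the intended one.\<close>
  let ?g = "\<lambda>k :: ('p \<times> nat) set.
    SOME z. is_pair z (urelement (THE p. (p, 0) \<in> k)) (urelement (THE q. (q, 1) \<in> k))"
  have "z = ?g {(p, 0), (q, 1)}" if "is_pair z (urelement p) (urelement q)" for z p q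
    using is_pair_unique[OF that someI[of "\<lambda>z. is_pair z (urelement p) (urelement q)", OF that]]
    by simp
  then show "{z. \<exists>p\<in>P. \<exists>q\<in>P. le p q \<and> is_pair z (urelement p) (urelement q)} \<subseteq> range ?g"
    by blast
qed

text \<open>This extracts from properness what the reading of names requires. One countable
  elementary submodel contains the order, \<open>p\<close> and all the dense sets, and its trace
  \<open>K\<close> on the urelements serves every \<open>n\<close> at once, so later arguments need
  no submodels.\<close>

lemma proper_forcing_generic:
  fixes P :: "'p set" and E :: "nat \<Rightarrow> 'p set"
  assumes "proper_forcing P le" "p \<in> P" and dense: "\<And>n. dense_in P le (E n)"
  obtains q K where "q \<in> P" "le q p" "countable K" "\<And>n. predense_below P le q (E n \<inter> K)"
proof -
  obtain e where e: "\<And>n. is_set (e n :: ('p, ('p \<times> nat) set) hereditary) (urelement ` E n)"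
  proof -
    have "\<exists>e. \<forall>n. is_set (e n :: ('p, ('p \<times> nat) set) hereditary) (urelement ` E n)"
      by (intro choice allI is_set_urelements_exists)
    then show ?thesis using that by blast
  qed
  obtain a where a: "is_set (a :: ('p, ('p \<times> nat) set) hereditary) (urelement ` P)"
    using is_set_urelements_exists by blast
  obtain b where b: "is_set (b :: ('p, ('p \<times> nat) set) hereditary)
      {z. \<exists>p\<in>P. \<exists>q\<in>P. le p q \<and> is_pair z (urelement p) (urelement q)}"
    using is_set_relation_exists by blast
  obtain M where M: "countable M" "insert a (insert b (insert (urelement p) (range e))) \<subseteq> M"
      "elementary_submodel M"
    using Loewenheim_Skolem[of "insert a (insert b (insert (urelement p) (range e)))"] by auto
  then obtain q where q: "q \<in> P" "le q p" "generic_condition M P le q"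
    using assms(1,2) a b unfolding proper_forcing_def by blast
  define K where "K = {d. urelement d \<in> M}"
  have "countable (urelement ` K :: ('p, ('p \<times> nat) set) hereditary set)"
    by (rule countable_subset[OF _ M(1)]) (auto simp: K_def)
  then have "countable K"
    by (rule countable_image_inj_on) (simp add: inj_on_def urelement_eq_iff)
  moreover have "predense_below P le q (E n \<inter> K)" for n
  proof -
    have "e n \<in> M" using M(2) by blast
    then have "predense_below P le q {d \<in> E n. urelement d \<in> M}"
      using q(3) dense[of n] e[of n] unfolding generic_condition_def by blast
    then show ?thesis by (simp add: K_def Int_def)
  qed
  ultimately show ?thesis using that q by blast
qed

section \<open>Borel reading of names\<close>

text \<open>For Borel sets \<open>B n\<close> this names the set of all \<open>n\<close> such that
  the generic point lies in \<open>B n\<close>.\<close>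

definition borel_name :: "'a::topological_space set set \<Rightarrow> (nat \<Rightarrow> 'a set) \<Rightarrow> 'a set real_name" where
  "borel_name I B n = {p \<in> P_ideal I. p \<subseteq> B n}"

text \<open>Expresses that below \<open>q\<close> the name evaluates to
  \<open>{n. x \<in> B n}\<close> at the generic point \<open>x\<close>. Only atomic statements are
  demanded; an induction on codes extends this to all Borel ones.\<close>

definition reads_below ::
    "'a::topological_space set set \<Rightarrow> 'a set real_name \<Rightarrow> (nat \<Rightarrow> 'a set) \<Rightarrow> 'a set \<Rightarrow> bool" where
  "reads_below I Y B q \<longleftrightarrow>
     (\<forall>n. \<forall>r\<in>P_ideal I. r \<subseteq> q \<longrightarrow> (forces (P_ideal I) (\<subseteq>) Y (BMem n) r \<longleftrightarrow> r - B n \<in> I))"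

lemma borel_decode:
  assumes "\<And>n. B n \<in> sets borel"
  shows "{x. {n. x \<in> B n} \<in> decode c} \<in> sets borel"
proof (induction c)
  case (BCompl c)
  then show ?case using sets.compl_sets[OF BCompl] by (simp add: set_diff_eq)
next
  case (BUnion f)
  have "{x. {n. x \<in> B n} \<in> decode (BUnion f)} = (\<Union>k. {x. {n. x \<in> B n} \<in> decode (f k)})" by auto
  then show ?case using BUnion by auto
qed (simp_all add: assms)

text \<open>Every clause of \<open>forces\<close> except the one for \<open>BEmpty\<close>, which is
  never forced, quantifies over all stronger conditions, so a case distinction on the code
  suffices.\<close>

lemma forces_mono:
  assumes "forces P (\<subseteq>) Y c p" "q \<subseteq> p"
  shows "forces P (\<subseteq>) Y c q"
proof -
  have "r \<subseteq> p" if "r \<subseteq> q" for r using that assms(2) by (rule subset_trans)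
  with assms(1) show ?thesis by (cases c) (simp_all add: dense_below_def)
qed

section \<open>The ideal, its positive Borel sets, and forcing as truth almost everywhere\<close>

context
  fixes I :: "'a::polish_space set set"
  assumes sigma_ideal: "sigma_ideal I"
begin

lemma ideal_subset: "A \<in> I \<Longrightarrow> B \<subseteq> A \<Longrightarrow> B \<in> I"
  using sigma_ideal unfolding sigma_ideal_def by blast

lemma ideal_UN: "(\<And>n::nat. F n \<in> I) \<Longrightarrow> (\<Union>n. F n) \<in> I"
  using sigma_ideal unfolding sigma_ideal_def by blast

lemma ideal_Un: "A \<in> I \<Longrightarrow> B \<in> I \<Longrightarrow> A \<union> B \<in> I"
  using ideal_UN[of "\<lambda>n. if n = 0 then A else B"] by (rule ideal_subset) auto

lemma ideal_countable_UN: "countable K \<Longrightarrow> (\<And>k. k \<in> K \<Longrightarrow> F k \<in> I) \<Longrightarrow> (\<Union>k\<in>K. F k) \<in> I"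
proof (cases "K = {}")
  case False
  assume "countable K" "\<And>k. k \<in> K \<Longrightarrow> F k \<in> I"
  then have "(\<Union>n. F (from_nat_into K n)) \<in> I"
    using False by (intro ideal_UN) (simp add: from_nat_into)
  moreover have "(\<Union>n. F (from_nat_into K n)) = (\<Union>k\<in>K. F k)"
    using range_from_nat_into[OF False \<open>countable K\<close>] by (metis image_image)
  ultimately show ?thesis by simp
qed (use sigma_ideal in \<open>simp add: sigma_ideal_def\<close>)

lemma P_ideal_Diff: "p \<in> P_ideal I \<Longrightarrow> E \<in> sets borel \<Longrightarrow> p - E \<notin> I \<Longrightarrow> p - E \<in> P_ideal I"
  by (auto simp: P_ideal_def)

lemma P_ideal_Int: "p \<in> P_ideal I \<Longrightarrow> E \<in> sets borel \<Longrightarrow> p \<inter> E \<notin> I \<Longrightarrow> p \<inter> E \<in> P_ideal I"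
  by (auto simp: P_ideal_def)

lemma P_ideal_notin: "p \<in> P_ideal I \<Longrightarrow> p \<notin> I"
  by (simp add: P_ideal_def)

lemma P_ideal_Int_positive: "p \<in> P_ideal I \<Longrightarrow> p - E \<in> I \<Longrightarrow> p \<inter> E \<notin> I"
  using ideal_Un[of "p - E" "p \<inter> E"] P_ideal_notin[of p] by (metis Un_Diff_Int)

text \<open>Induction on the code. Positive Borel parts of a condition are conditions themselves,
  which handles complements. Sigma-additivity turns a positive part of a countable union into a
  positive part of one member.\<close>

lemma forces_iff_almost_everywhere:
  assumes B: "\<And>n. B n \<in> sets borel" and reads: "reads_below I Y B q"
  shows "p \<in> P_ideal I \<Longrightarrow> p \<subseteq> q \<Longrightarrow>
    forces (P_ideal I) (\<subseteq>) Y c p \<longleftrightarrow> p - {x. {n. x \<in> B n} \<in> decode c} \<in> I"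
proof (induction c arbitrary: p)
  case BEmpty
  then show ?case by (simp add: P_ideal_def)
next
  case (BMem n)
  then show ?case using reads by (simp add: reads_below_def)
next
  case (BCompl c)
  define E where "E = {x. {n. x \<in> B n} \<in> decode c}"
  have E_borel: "E \<in> sets borel" unfolding E_def by (rule borel_decode[OF B])
  have IH: "forces (P_ideal I) (\<subseteq>) Y c r \<longleftrightarrow> r - E \<in> I" if "r \<in> P_ideal I" "r \<subseteq> p" for r
    using BCompl.IH[of r] that BCompl.prems by (auto simp: E_def)
  have eq: "p - {x. {n. x \<in> B n} \<in> decode (BCompl c)} = p \<inter> E" by (auto simp: E_def)
  show ?case
  proof
    assume L: "forces (P_ideal I) (\<subseteq>) Y (BCompl c) p"
    show "p - {x. {n. x \<in> B n} \<in> decode (BCompl c)} \<in> I"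
    proof (rule ccontr)
      assume "\<not> ?thesis"
      \<comment> \<open>The part of \<open>p\<close> inside \<open>E\<close> would be a condition
        that forces \<open>c\<close>, which \<open>L\<close> forbids.\<close>
      then have r: "p \<inter> E \<in> P_ideal I"
        unfolding eq by (rule P_ideal_Int[OF BCompl.prems(1) E_borel])
      have "(p \<inter> E) - E \<in> I" using sigma_ideal by (simp add: sigma_ideal_def Diff_eq Int_assoc)
      then show False using L IH[OF r] r by auto
    qed
  next
    assume "p - {x. {n. x \<in> B n} \<in> decode (BCompl c)} \<in> I"
    then have pE: "p \<inter> E \<in> I" by (simp only: eq)
    \<comment> \<open>A condition contained in \<open>E\<close> up to the ideal meets
      \<open>E\<close> in a positive set, which cannot be a subset of
      \<open>p \<inter> E\<close>.\<close>
    have False if "r \<in> P_ideal I" "r \<subseteq> p" "r - E \<in> I" for r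
      using P_ideal_Int_positive[OF that(1,3)] ideal_subset[OF pE, of "r \<inter> E"] that(2) by blast
    then show "forces (P_ideal I) (\<subseteq>) Y (BCompl c) p" using IH by auto
  qed
next
  case (BUnion f)
  define E where "E k = {x. {n. x \<in> B n} \<in> decode (f k)}" for k
  have E_borel: "E k \<in> sets borel" for k unfolding E_def by (rule borel_decode[OF B])
  have IH: "forces (P_ideal I) (\<subseteq>) Y (f k) r \<longleftrightarrow> r - E k \<in> I" if "r \<in> P_ideal I" "r \<subseteq> p" for r k
    using BUnion.IH[of "f k" r] that BUnion.prems by (auto simp: E_def)
  have eq: "p - {x. {n. x \<in> B n} \<in> decode (BUnion f)} = p - (\<Union>k. E k)" by (auto simp: E_def)
  show ?case
  proof
    assume L: "forces (P_ideal I) (\<subseteq>) Y (BUnion f) p"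
    show "p - {x. {n. x \<in> B n} \<in> decode (BUnion f)} \<in> I"
    proof (rule ccontr)
      assume "\<not> ?thesis"
      \<comment> \<open>The points of \<open>p\<close> outside every \<open>E k\<close> would form a
        condition. Some stronger \<open>r\<close> would force one \<open>f k\<close> and so lie in
        \<open>E k\<close> up to the ideal, although it is disjoint from \<open>E k\<close>.\<close>
      then have "p - (\<Union>k. E k) \<in> P_ideal I"
        using BUnion.prems(1) E_borel unfolding eq by (intro P_ideal_Diff) auto
      then obtain r k where r: "r \<in> P_ideal I" "r \<subseteq> p - (\<Union>k. E k)" "forces (P_ideal I) (\<subseteq>) Y (f k) r"
        using L by (auto simp: dense_below_def)
      then have "r - E k \<in> I" using IH[of r k] by blast
      moreover have "r - E k = r" using r(2) by blast
      ultimately show False using r(1) P_ideal_notin by simp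
    qed
  next
    assume R: "p - {x. {n. x \<in> B n} \<in> decode (BUnion f)} \<in> I"
    have "\<exists>t\<in>P_ideal I. t \<subseteq> r \<and> (\<exists>k. forces (P_ideal I) (\<subseteq>) Y (f k) t)"
      if r: "r \<in> P_ideal I" "r \<subseteq> p" for r
    proof -
      \<comment> \<open>Up to the ideal \<open>r\<close> lies in the union, so some
        \<open>E k\<close> meets it positively, and this intersection is the stronger condition
        sought.\<close>
      have "r - (\<Union>k. E k) \<in> I" by (rule ideal_subset[OF R[unfolded eq]]) (use r(2) in blast)
      then have "r \<inter> (\<Union>k. E k) \<notin> I" by (rule P_ideal_Int_positive[OF r(1)])
      then obtain k where "r \<inter> E k \<notin> I" using ideal_UN[of "\<lambda>k. r \<inter> E k"] by auto
      then have t: "r \<inter> E k \<in> P_ideal I" using P_ideal_Int r(1) E_borel by blast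
      have "(r \<inter> E k) - E k \<in> I" using sigma_ideal by (simp add: sigma_ideal_def Diff_eq Int_assoc)
      then have "forces (P_ideal I) (\<subseteq>) Y (f k) (r \<inter> E k)" using IH[OF t] r(2) by blast
      then show ?thesis using t by blast
    qed
    then show "forces (P_ideal I) (\<subseteq>) Y (BUnion f) p" by (simp add: dense_below_def)
  qed
qed

text \<open>A positive \<open>r - B n\<close> would be a condition with no strengthening inside
  \<open>B n\<close>. Conversely, a condition contained in \<open>B n\<close> up to the ideal can be
  cut down to \<open>B n\<close>, and the result is itself paired with \<open>n\<close> in the
  name.\<close>

lemma reads_below_borel_name:
  assumes B: "\<And>n. B n \<in> sets borel"
  shows "reads_below I (borel_name I B) B q"
  unfolding reads_below_def
proof (intro allI ballI impI iffI)
  fix n r assume r: "r \<in> P_ideal I" and L: "forces (P_ideal I) (\<subseteq>) (borel_name I B) (BMem n) r"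
  show "r - B n \<in> I"
  proof (rule ccontr)
    assume "r - B n \<notin> I"
    then have "r - B n \<in> P_ideal I" using r B by (intro P_ideal_Diff)
    then obtain t where "t \<in> P_ideal I" "t \<subseteq> r - B n" "t \<subseteq> B n"
      using L by (auto simp: dense_below_def borel_name_def)
    then have "t = {}" "t \<notin> I" using P_ideal_notin by auto
    then show False using sigma_ideal by (simp add: sigma_ideal_def)
  qed
next
  fix n r assume r: "r \<in> P_ideal I" and R: "r - B n \<in> I"
  have "\<exists>u\<in>P_ideal I. u \<subseteq> t \<and> (\<exists>s\<in>borel_name I B n. u \<subseteq> s)" if "t \<in> P_ideal I" "t \<subseteq> r" for t
  proof -
    have "t - B n \<in> I" by (rule ideal_subset[OF R]) (use that(2) in blast)
    then have "t \<inter> B n \<in> P_ideal I" using P_ideal_Int_positive P_ideal_Int that(1) B by blast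
    then show ?thesis by (auto simp: borel_name_def)
  qed
  then show "forces (P_ideal I) (\<subseteq>) (borel_name I B) (BMem n) r" by (simp add: dense_below_def)
qed

lemma proper_borel_reading:
  assumes proper: "proper_forcing (P_ideal I) (\<subseteq>)"
    and p: "p \<in> P_ideal I"
  obtains q B where "q \<in> P_ideal I" "q \<subseteq> p" "\<And>n. B n \<in> sets borel" "reads_below I Y B q"
proof -
  let ?P = "P_ideal I"
  \<comment> \<open>The conditions that decide \<open>n \<in> Y\<close>: those below a member of
    \<open>Y n\<close> force it, those incompatible with all of \<open>Y n\<close> force its
    negation.\<close>
  define E where "E n = {d \<in> ?P. (\<exists>s\<in>Y n. d \<subseteq> s) \<or> (\<forall>s\<in>Y n. \<not> compatible ?P (\<subseteq>) d s)}" for n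
  have "dense_in ?P (\<subseteq>) (E n)" for n
    unfolding dense_in_def
  proof (intro conjI ballI)
    fix r assume r: "r \<in> ?P"
    show "\<exists>d\<in>E n. d \<subseteq> r"
    proof (cases "\<exists>s\<in>Y n. compatible ?P (\<subseteq>) r s")
      case True
      then obtain s d where "s \<in> Y n" "d \<in> ?P" "d \<subseteq> r" "d \<subseteq> s" unfolding compatible_def by blast
      then show ?thesis by (auto simp: E_def)
    next
      case False
      then show ?thesis using r by (auto simp: E_def)
    qed
  qed (auto simp: E_def)
  then obtain q K where q: "q \<in> ?P" "q \<subseteq> p" "countable K"
      and predense: "\<And>n. predense_below ?P (\<subseteq>) q (E n \<inter> K)"
    using proper_forcing_generic[OF proper p] by metis
  \<comment> \<open>Only the positive decisions in \<open>K\<close> enter; as \<open>K\<close> is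
    countable, their union is Borel.\<close>
  define B where "B n = \<Union>{d \<in> E n \<inter> K. \<exists>s\<in>Y n. d \<subseteq> s}" for n
  have B: "B n \<in> sets borel" for n
    unfolding B_def
  proof (rule sets.countable_Union)
    show "countable {d \<in> E n \<inter> K. \<exists>s\<in>Y n. d \<subseteq> s}"
      by (rule countable_subset[OF _ q(3)]) auto
  qed (auto simp: E_def P_ideal_def)
  have "reads_below I Y B q"
    unfolding reads_below_def
  proof (intro allI ballI impI iffI)
    fix n r assume r: "r \<in> ?P" "r \<subseteq> q" and L: "forces ?P (\<subseteq>) Y (BMem n) r"
    show "r - B n \<in> I"
    proof (rule ccontr)
      assume "r - B n \<notin> I"
      then have "r - B n \<in> ?P" using r B by (intro P_ideal_Diff)
      then obtain t s where t: "t \<in> ?P" "t \<subseteq> r - B n" "t \<subseteq> s" "s \<in> Y n"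
        using L by (auto simp: dense_below_def)
      \<comment> \<open>Predensity yields \<open>d\<close> with a common extension \<open>u\<close>
        of \<open>d\<close> and \<open>t\<close>. Since \<open>u\<close> also lies below
        \<open>s\<close>, the decision made by \<open>d\<close> is positive, so \<open>u\<close>
        lies inside \<open>B n\<close>, which \<open>t\<close> avoids.\<close>
      then obtain d u where d: "d \<in> E n \<inter> K" and u: "u \<in> ?P" "u \<subseteq> t" "u \<subseteq> d"
        using predense[of n] r(2) unfolding predense_below_def compatible_def by blast
      have "compatible ?P (\<subseteq>) d s" using u t(3) unfolding compatible_def by blast
      then have "d \<subseteq> B n" using d t(4) by (auto simp: E_def B_def)
      then have "u = {}" using u t(2) by blast
      then show False using u(1) sigma_ideal by (simp add: P_ideal_def sigma_ideal_def)
    qed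
  next
    fix n r assume r: "r \<in> ?P" "r \<subseteq> q" and R: "r - B n \<in> I"
    have "\<exists>u\<in>?P. u \<subseteq> t \<and> (\<exists>s\<in>Y n. u \<subseteq> s)" if t: "t \<in> ?P" "t \<subseteq> r" for t
    proof -
      have "t - B n \<in> I" by (rule ideal_subset[OF R]) (use t(2) in blast)
      then have tB: "t \<inter> B n \<notin> I" by (rule P_ideal_Int_positive[OF t(1)])
      \<comment> \<open>If all pieces \<open>t \<inter> d\<close> were in the ideal, so would be
        their countable union \<open>t \<inter> B n\<close>.\<close>
      obtain d where d: "d \<in> E n \<inter> K" "\<exists>s\<in>Y n. d \<subseteq> s" "t \<inter> d \<notin> I"
      proof (rule ccontr)
        assume "\<not> thesis"
        then have "\<And>d. d \<in> {d \<in> E n \<inter> K. \<exists>s\<in>Y n. d \<subseteq> s} \<Longrightarrow> t \<inter> d \<in> I" using that by blast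
        moreover have "countable {d \<in> E n \<inter> K. \<exists>s\<in>Y n. d \<subseteq> s}"
          by (rule countable_subset[OF _ q(3)]) auto
        ultimately have "(\<Union>d\<in>{d \<in> E n \<inter> K. \<exists>s\<in>Y n. d \<subseteq> s}. t \<inter> d) \<in> I"
          by (rule ideal_countable_UN[rotated])
        moreover have "(\<Union>d\<in>{d \<in> E n \<inter> K. \<exists>s\<in>Y n. d \<subseteq> s}. t \<inter> d) = t \<inter> B n"
          unfolding B_def by blast
        ultimately show False using tB by simp
      qed
      have "t \<inter> d \<in> ?P" using t(1) d(1,3) by (auto simp: P_ideal_def E_def)
      then show ?thesis using d(2) by blast
    qed
    then show "forces ?P (\<subseteq>) Y (BMem n) r" by (simp add: dense_below_def)
  qed
  then show ?thesis using that q B by blast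
qed

section \<open>Translation between Borel sequences and destroying names\<close>

lemma can_destroy_if_borel_sequence:
  assumes B: "\<And>n. B n \<in> sets borel" and D: "{x. {n. x \<in> B n} \<in> decode c} \<notin> I"
    and small: "\<And>S. S \<in> J \<Longrightarrow> {x. infinite {n \<in> S. x \<in> B n}} \<in> I"
  shows "can_destroy (P_ideal I) (\<subseteq>) (decode c) J"
proof -
  let ?P = "P_ideal I"
  \<comment> \<open>This set is the destroying condition: all its points satisfy the requirement on
    the family, and for each \<open>A\<close> in \<open>J\<close> almost all of them satisfy the
    finiteness requirement.\<close>
  define p where "p = {x. {n. x \<in> B n} \<in> decode c}"
  have p: "p \<in> ?P" using D borel_decode[of B c] B by (simp add: p_def P_ideal_def)
  note iff = forces_iff_almost_everywhere[OF B reads_below_borel_name[OF B], of p p]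
  have name: "is_name ?P (borel_name I B)" by (auto simp: is_name_def borel_name_def)
  have empty: "{} \<in> I" using sigma_ideal by (simp add: sigma_ideal_def)
  have forces_D: "forces ?P (\<subseteq>) (borel_name I B) c p"
    using iff[OF p subset_refl] empty by (simp add: p_def)
  have forces_fin: "forces ?P (\<subseteq>) (borel_name I B) (fin_inter_code A) p" if "A \<in> J" for A
  proof -
    have "p - {x. {n. x \<in> B n} \<in> decode (fin_inter_code A)} \<subseteq> {x. infinite {n \<in> A. x \<in> B n}}"
      by (auto simp: decode_fin_inter_code Int_def conj_commute)
    from ideal_subset[OF small[OF that] this] show ?thesis by (simp only: iff[OF p subset_refl])
  qed
  have "forces_destroyed ?P (\<subseteq>) (decode c) J p"
    unfolding forces_destroyed_def dense_below_def forces_in_def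
  proof (intro ballI impI)
    fix q assume q: "q \<in> ?P" "q \<subseteq> p"
    show "\<exists>r\<in>?P. r \<subseteq> q \<and> (\<exists>Y. is_name ?P Y \<and> (\<exists>c'. decode c' = decode c \<and> forces ?P (\<subseteq>) Y c' r) \<and>
        (\<forall>A\<in>J. forces ?P (\<subseteq>) Y (fin_inter_code A) r))"
    proof (intro bexI[OF _ q(1)] conjI exI[of _ "borel_name I B"] exI[of _ c] ballI)
      show "forces ?P (\<subseteq>) (borel_name I B) c q" by (rule forces_mono[OF forces_D q(2)])
      show "forces ?P (\<subseteq>) (borel_name I B) (fin_inter_code A) q" if "A \<in> J" for A
        by (rule forces_mono[OF forces_fin[OF that] q(2)])
    qed (simp_all add: name)
  qed
  then show ?thesis using p by (auto simp: can_destroy_def)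
qed

lemma borel_sequence_if_can_destroy:
  assumes proper: "proper_forcing (P_ideal I) (\<subseteq>)"
    and "can_destroy (P_ideal I) (\<subseteq>) D J"
  obtains B :: "nat \<Rightarrow> 'a set" where "\<And>n. B n \<in> sets borel" "{x. {n. x \<in> B n} \<in> D} \<notin> I"
    "\<And>S. S \<in> J \<Longrightarrow> {x. infinite {n \<in> S. x \<in> B n}} \<in> I"
proof -
  let ?P = "P_ideal I"
  \<comment> \<open>Density below the destroying condition, applied to that condition itself, gives
    a single \<open>p\<close> with a fixed witnessing name and code.\<close>
  obtain p Y c where p: "p \<in> ?P" and c: "decode c = D"
    and forces_D: "forces ?P (\<subseteq>) Y c p"
    and forces_fin: "\<And>A. A \<in> J \<Longrightarrow> forces ?P (\<subseteq>) Y (fin_inter_code A) p"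
  proof -
    obtain p0 where "p0 \<in> ?P" "forces_destroyed ?P (\<subseteq>) D J p0"
      using assms(2) unfolding can_destroy_def by blast
    then obtain p Y where pY: "p \<in> ?P" "forces_in ?P (\<subseteq>) Y D p"
        "\<forall>A\<in>J. forces ?P (\<subseteq>) Y (fin_inter_code A) p"
      unfolding forces_destroyed_def dense_below_def by (meson subset_refl)
    then obtain c where "decode c = D" "forces ?P (\<subseteq>) Y c p"
      unfolding forces_in_def by blast
    then show ?thesis by (rule that[OF pY(1) _ _ bspec[OF pY(3)]])
  qed
  obtain q B where q: "q \<in> ?P" "q \<subseteq> p" and B: "\<And>n. B n \<in> sets borel" and reads: "reads_below I Y B q"
    using proper_borel_reading[OF proper p] by metis
  have almost: "q - {x. {n. x \<in> B n} \<in> decode c'} \<in> I" if "forces ?P (\<subseteq>) Y c' p" for c'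
    using forces_mono[OF that q(2)]
    by (simp only: forces_iff_almost_everywhere[OF B reads q(1) subset_refl])
  show ?thesis
  \<comment> \<open>The forced statements say nothing about points outside \<open>q\<close>.
    Intersecting with \<open>q\<close> makes the index sets empty there and leaves them unchanged on
    \<open>q\<close>, so the points with infinite trace on \<open>S\<close> are confined to
    \<open>q\<close>.\<close>
  proof (rule that[of "\<lambda>n. B n \<inter> q"])
    show "B n \<inter> q \<in> sets borel" for n using B q(1) by (auto simp: P_ideal_def)
    have positive: "q \<inter> {x. {n. x \<in> B n} \<in> D} \<notin> I" (is "?A \<notin> I")
      by (rule P_ideal_Int_positive[OF q(1) almost[OF forces_D, unfolded c]])
    have sub: "?A \<subseteq> {x. {n. x \<in> B n \<inter> q} \<in> D}" by auto
    show "{x. {n. x \<in> B n \<inter> q} \<in> D} \<notin> I"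
    proof
      assume "{x. {n. x \<in> B n \<inter> q} \<in> D} \<in> I"
      from ideal_subset[OF this sub] positive show False by contradiction
    qed
  next
    fix S assume "S \<in> J"
    have "x \<in> q \<and> infinite ({n. x \<in> B n} \<inter> S)" if "infinite {n \<in> S. x \<in> B n \<inter> q}" for x
    proof
      show "x \<in> q" using that by (rule contrapos_np) simp
      have "{n \<in> S. x \<in> B n \<inter> q} \<subseteq> {n. x \<in> B n} \<inter> S" by blast
      then show "infinite ({n. x \<in> B n} \<inter> S)" using that by (rule infinite_super)
    qed
    then have "{x. infinite {n \<in> S. x \<in> B n \<inter> q}} \<subseteq> q - {x. {n. x \<in> B n} \<in> decode (fin_inter_code S)}"
      by (auto simp: decode_fin_inter_code)
    then show "{x. infinite {n \<in> S. x \<in> B n \<inter> q}} \<in> I"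
      by (rule ideal_subset[OF almost[OF forces_fin[OF \<open>S \<in> J\<close>]]])
  qed
qed

end

section \<open>Borel codes for the three families, and the equivalence\<close>

lemma decode_vimage_Compl: "\<exists>c'. decode c' = {Y. - Y \<in> decode c}"
proof (induction c)
  case BEmpty
  show ?case by (intro exI[of _ BEmpty]) simp
next
  case (BMem n)
  \<comment> \<open>Passing to complements negates the atoms; the remaining constructors commute
    with taking preimages.\<close>
  show ?case by (intro exI[of _ "BCompl (BMem n)"]) auto
next
  case (BCompl c)
  then obtain c' where "decode c' = {Y. - Y \<in> decode c}" by blast
  then show ?case by (intro exI[of _ "BCompl c'"]) auto
next
  case (BUnion f)
  then obtain g where "\<And>n. decode (g n) = {Y. - Y \<in> decode (f n)}" by (metis rangeI)
  then show ?case by (intro exI[of _ "BUnion g"]) auto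
qed

lemma dual_filter_eq: "dual_filter J = {Y. - Y \<in> J}"
  unfolding dual_filter_def Compl_eq_Diff_UNIV[symmetric] by (metis (mono_tags, lifting) double_complement)

theorem theorem3p3:
  fixes J D :: "nat set set" and I :: "'a::polish_space set set"
  assumes "ideal_on_omega J" and "borel_family J"
    and "D = {Y. infinite Y} \<or> D = positive_sets J \<or> D = dual_filter J"
    and "uncountable (UNIV :: 'a set)"
    and "sigma_ideal I"
    and "proper_forcing (P_ideal I) (\<subseteq>)"
  shows "\<not> can_destroy (P_ideal I) (\<subseteq>) D J \<longleftrightarrow>
    (\<forall>B :: nat \<Rightarrow> 'a set. (\<forall>n. B n \<in> sets borel) \<longrightarrow>
       {x. {n. x \<in> B n} \<in> D} \<notin> I \<longrightarrow>
       (\<exists>S\<in>J. {x. infinite {n \<in> S. x \<in> B n}} \<notin> I))"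
proof -
  obtain j where j: "decode j = J" using assms(2) borel_family_iff_decode by blast
  \<comment> \<open>All three families are Borel: the infinite sets are those whose intersection
    with \<open>UNIV\<close> is not finite, the positive sets are the complement of
    \<open>J\<close>, and the dual filter is the preimage of \<open>J\<close> under
    complementation.\<close>
  have "\<exists>c. decode c = D"
    using assms(3)
  proof (elim disjE)
    assume "D = {Y. infinite Y}"
    then show ?thesis
      by (intro exI[of _ "BCompl (fin_inter_code UNIV)"]) (auto simp: decode_fin_inter_code)
  next
    assume "D = positive_sets J"
    then show ?thesis by (intro exI[of _ "BCompl j"]) (simp add: j positive_sets_def)
  next
    assume "D = dual_filter J"
    then show ?thesis using decode_vimage_Compl[of j] by (simp add: j dual_filter_eq)
  qed
  then obtain c where c: "decode c = D" by blast
  show ?thesis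
  proof
    assume "\<not> can_destroy (P_ideal I) (\<subseteq>) D J"
    then show "\<forall>B :: nat \<Rightarrow> 'a set. (\<forall>n. B n \<in> sets borel) \<longrightarrow>
       {x. {n. x \<in> B n} \<in> D} \<notin> I \<longrightarrow>
       (\<exists>S\<in>J. {x. infinite {n \<in> S. x \<in> B n}} \<notin> I)"
      using can_destroy_if_borel_sequence[OF assms(5), where c = c and J = J] unfolding c by blast
  next
    assume *: "\<forall>B :: nat \<Rightarrow> 'a set. (\<forall>n. B n \<in> sets borel) \<longrightarrow>
       {x. {n. x \<in> B n} \<in> D} \<notin> I \<longrightarrow>
       (\<exists>S\<in>J. {x. infinite {n \<in> S. x \<in> B n}} \<notin> I)"
    show "\<not> can_destroy (P_ideal I) (\<subseteq>) D J"
    proof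
      assume "can_destroy (P_ideal I) (\<subseteq>) D J"
      then obtain B :: "nat \<Rightarrow> 'a set" where "\<And>n. B n \<in> sets borel" "{x. {n. x \<in> B n} \<in> D} \<notin> I"
        "\<And>S. S \<in> J \<Longrightarrow> {x. infinite {n \<in> S. x \<in> B n}} \<in> I"
        using borel_sequence_if_can_destroy[OF assms(5,6)] by blast
      with * show False by blast
    qed
  qed
qed

end
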